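(* Let $\lambda>0$, let $N\ge 2$, and for each $i=1,\dots,N$ let $\mathbf{\Phi}^{(i)}\in\mathbb{R}^{N_i\times d}$ be the projected feature matrix and $\mathbf{Y}^{(i)}\in\{0,1\}^{N_i\times c_i}$ the one-hot label matrix of the $i$-th domain, where the label sets of different domains are disjoint. Define $\mathbf{M}_p^{(1)}=\left(\mathbf{\Phi}^{(1)\top}\mathbf{\Phi}^{(1)}+\lambda\mathbf{I}\right)^{-1}$ and $\mathbf{W}^{(1)}=\mathbf{M}_p^{(1)}\mathbf{\Phi}^{(1)\top}\mathbf{Y}^{(1)}$, and for $2\le n\le N$ define recursively $$\mathbf{M}_p^{(n)}=\mathbf{M}_p^{(n-1)}-\mathbf{M}_p^{(n-1)}\mathbf{\Phi}^{(n)\top}\left(\mathbf{I}+\mathbf{\Phi}^{(n)}\mathbf{M}_p^{(n-1)}\mathbf{\Phi}^{(n)\top}\right)^{-1}\mathbf{\Phi}^{(n)}\mathbf{M}_p^{(n-1)},$$ $$\mathbf{W}^{(n)}=\begin{bmatrix}\mathbf{W}^{(n-1)}-\mathbf{M}_p^{(n)}\mathbf{\Phi}^{(n)\top}\mathbf{\Phi}^{(n)}\mathbf{W}^{(n-1)} & \mathbf{M}_p^{(n)}\mathbf{\Phi}^{(n)\top}\mathbf{Y}^{(n)}\end{bmatrix}.$$ Then for every $2\le n\le N$ the matrix $\mathbf{W}^{(n)}\in\mathbb{R}^{d\times(c_1+\cdots+c_n)}$ is an optimal solution of the joint training problem on all first $n$ domains, i.e. it minimizes $$\left\|\mathbf{Y}^{(1:n)}-\mathbf{\Phi}^{(1:n)}\mathbf{W}\right\|_F^2+\lambda\left\|\mathbf{W}\right\|_F^2$$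 over all $\mathbf{W}\in\mathbb{R}^{d\times(c_1+\cdots+c_n)}$.
   Context: Domains $1,\dots,N$ arrive sequentially. Domain $i$ has $N_i$ training samples, whose features (produced by a fixed image encoder) form the rows of a matrix $\mathbf{X}_e^{(i)}\in\mathbb{R}^{N_i\times p}$, and $\mathbf{\Phi}^{(i)}=\phi(\mathbf{X}_e^{(i)})\in\mathbb{R}^{N_i\times d}$, where $\phi:\mathbb{R}^p\to\mathbb{R}^d$ is a fixed map applied row by row. Each row of $\mathbf{Y}^{(i)}$ is the one-hot encoding of the sample's class among the $c_i$ classes of domain $i$. Joint data for the first $n$ domains: $\mathbf{\Phi}^{(1:n)}$ is the vertical concatenation (stacking of rows) of $\mathbf{\Phi}^{(1)},\dots,\mathbf{\Phi}^{(n)}$. Because the label sets of different domains are disjoint, $\mathbf{Y}^{(1:n)}$ is the block-diagonal matrix $\mathrm{diag}(\mathbf{Y}^{(1)},\dots,\mathbf{Y}^{(n)})$ of size $(N_1+\cdots+N_n)\times(c_1+\cdots+c_n)$. $\|\cdot\|_F$ is the Frobenius norm and $\mathbf{I}$ denotes identity matrices of the appropriate size. *)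

theory Defs
  imports
    Complex_Main
    "Jordan_Normal_Form.Matrix"
    "Jordan_Normal_Form.Gauss_Jordan_Elimination"
begin

(* mat_inverse returns None for singular matrices; mat_inv A is the inverse of A
   when A is invertible and is unspecified otherwise. *)
definition mat_inv :: "'a :: field mat \<Rightarrow> 'a mat" where
  "mat_inv A = the (mat_inverse A)"

lemma mat_inv_inverts:
  assumes A: "A \<in> carrier_mat n n" and inv: "invertible_mat A"
  shows "mat_inv A \<in> carrier_mat n n" "A * mat_inv A = 1\<^sub>m n" "mat_inv A * A = 1\<^sub>m n"
proof -
  obtain B where AB: "A * B = 1\<^sub>m (dim_row A)" and BA: "B * A = 1\<^sub>m (dim_row B)"
    using inv unfolding invertible_mat_def inverts_mat_def by blast
  have "dim_col B = n"
    using arg_cong[OF AB, of dim_col] A by simp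
  moreover have "dim_row B = n"
    using arg_cong[OF BA, of dim_col] A by simp
  ultimately have B: "B \<in> carrier_mat n n" by auto
  have "A \<in> Units (ring_mat TYPE('a) n ())"
    unfolding Units_def ring_mat_def using A B AB BA by auto
  then obtain C where "mat_inverse A = Some C"
    using mat_inverse(1)[OF A, of "()"] by (cases "mat_inverse A") auto
  then show "mat_inv A \<in> carrier_mat n n" "A * mat_inv A = 1\<^sub>m n" "mat_inv A * A = 1\<^sub>m n"
    using mat_inverse(2)[OF A] by (auto simp: mat_inv_def)
qed

definition append_cols :: "'a :: zero mat \<Rightarrow> 'a mat \<Rightarrow> 'a mat" where
  "append_cols A B = four_block_mat A B (0\<^sub>m 0 (dim_col A)) (0\<^sub>m 0 (dim_col B))"

definition stack_rows :: "nat \<Rightarrow> 'a mat list \<Rightarrow> 'a mat" where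
  "stack_rows d As = mat_of_rows d (concat (map rows As))"

definition frob_norm :: "real mat \<Rightarrow> real" where
  "frob_norm A = sqrt (\<Sum>i<dim_row A. \<Sum>j<dim_col A. (A $$ (i, j))\<^sup>2)"

definition one_hot_rows :: "real mat \<Rightarrow> bool" where
  "one_hot_rows A \<longleftrightarrow> (\<forall>r<dim_row A. \<exists>j<dim_col A. row A r = unit_vec (dim_col A) j)"

definition feature_mat :: "nat \<Rightarrow> (real vec \<Rightarrow> real vec) \<Rightarrow> real mat \<Rightarrow> real mat" where
  "feature_mat d \<phi> X = mat_of_rows d (map \<phi> (rows X))"

definition joint_features :: "nat \<Rightarrow> (nat \<Rightarrow> real mat) \<Rightarrow> nat \<Rightarrow> real mat" where
  "joint_features d \<Phi> n = stack_rows d (map \<Phi> [1..<Suc n])"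

(* The block-diagonal form encodes that distinct domains have disjoint label sets:
   every class of every domain has a column of its own. *)
definition joint_labels :: "(nat \<Rightarrow> real mat) \<Rightarrow> nat \<Rightarrow> real mat" where
  "joint_labels Y n = diag_block_mat (map Y [1..<Suc n])"

(* Domains are numbered from 1, so the recursions start at Suc 0; the values at 0
   are unspecified. *)
fun Mp :: "real \<Rightarrow> nat \<Rightarrow> (nat \<Rightarrow> real mat) \<Rightarrow> nat \<Rightarrow> real mat" where
  "Mp lam d \<Phi> (Suc 0) = mat_inv ((\<Phi> 1)\<^sup>T * \<Phi> 1 + lam \<cdot>\<^sub>m 1\<^sub>m d)"
| "Mp lam d \<Phi> (Suc (Suc k)) =
    (let M = Mp lam d \<Phi> (Suc k); F = \<Phi> (Suc (Suc k)) in
     M - M * F\<^sup>T * mat_inv (1\<^sub>m (dim_row F) + F * M * F\<^sup>T) * F * M)"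

fun Wt :: "real \<Rightarrow> nat \<Rightarrow> (nat \<Rightarrow> real mat) \<Rightarrow> (nat \<Rightarrow> real mat) \<Rightarrow> nat \<Rightarrow> real mat" where
  "Wt lam d \<Phi> Y (Suc 0) = Mp lam d \<Phi> 1 * (\<Phi> 1)\<^sup>T * Y 1"
| "Wt lam d \<Phi> Y (Suc (Suc k)) =
    (let n = Suc (Suc k); M = Mp lam d \<Phi> n; F = \<Phi> n; W = Wt lam d \<Phi> Y (Suc k) in
     append_cols (W - M * F\<^sup>T * F * W) (M * F\<^sup>T * Y n))"

definition joint_objective ::
    "real \<Rightarrow> nat \<Rightarrow> (nat \<Rightarrow> real mat) \<Rightarrow> (nat \<Rightarrow> real mat) \<Rightarrow> nat \<Rightarrow> real mat \<Rightarrow> real" where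
  "joint_objective lam d \<Phi> Y n W =
     (frob_norm (joint_labels Y n - joint_features d \<Phi> n * W))\<^sup>2 + lam * (frob_norm W)\<^sup>2"

end

(* W is a ridge regression solution as soon as it satisfies the normal equation
   (F^T F + lam I) W = F^T Y: completing the square, the objective at any other
   W' exceeds that at W by |F (W - W')|^2 + lam |W - W'|^2. So it suffices to carry the
   invariant A_n M_n = I and A_n W_n = F_n^T Y_n through the recursion, where
   A_n = F_n^T F_n + lam I for the stacked features F_n, so that A_n = A_(n-1) + F^T F
   with F the new feature block. The first part is the Woodbury identity; for the second,
   A_n (W_(n-1) - M_n F^T F W_(n-1)) = A_(n-1) W_(n-1), while A_n M_n F^T Y = F^T Y, which are
   the two column blocks of F_n^T Y_n because the joint label matrix is block diagonal. *)
theory Submission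
  imports Defs "Jordan_Normal_Form.Determinant"
begin

section \<open>Invertibility from a trivial kernel\<close>

text \<open>Reduces reasoning about \<open>mat_inv\<close> to a test on vectors: over a field a
  trivial kernel forces a nonzero determinant, hence a unit of the matrix ring, where
  \<open>mat_inv\<close> is specified.\<close>

lemma nonsingular_mat_inv:
  fixes A :: "'a :: field mat"
  assumes A: "A \<in> carrier_mat n n"
    and ker: "\<And>v. v \<in> carrier_vec n \<Longrightarrow> A *\<^sub>v v = 0\<^sub>v n \<Longrightarrow> v = 0\<^sub>v n"
  shows "mat_inv A \<in> carrier_mat n n" "A * mat_inv A = 1\<^sub>m n"
proof -
  have "det A \<noteq> 0"
    using det_0_iff_vec_prod_zero_field[OF A] ker by blast
  then obtain B where "B \<in> carrier_mat n n" "A * B = 1\<^sub>m n" "B * A = 1\<^sub>m n"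
    using det_non_zero_imp_unit[OF A, of undefined]
    unfolding Units_def ring_mat_def by auto
  then have "invertible_mat A"
    using A unfolding invertible_mat_def inverts_mat_def by auto
  then show "mat_inv A \<in> carrier_mat n n" "A * mat_inv A = 1\<^sub>m n"
    using mat_inv_inverts[OF A] by auto
qed

lemma scalar_prod_self_nonneg: "0 \<le> v \<bullet> (v :: real vec)"
  by (simp add: scalar_prod_def sum_nonneg)

lemma scalar_prod_self_eq_0:
  fixes v :: "real vec"
  assumes "v \<in> carrier_vec n" "v \<bullet> v \<le> 0"
  shows "v = 0\<^sub>v n"
  using assms sum_nonneg_eq_0_iff[of "{0..<n}" "\<lambda>i. v $ i * v $ i"]
  by (intro eq_vecI) (auto simp: scalar_prod_def sum_nonneg antisym)

section \<open>The ridge Gram matrix and its positive definiteness\<close>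

text \<open>The matrix of the normal equations, which is half the Hessian of the ridge objective for
  a single column.\<close>

definition ridge_gram :: "real \<Rightarrow> real mat \<Rightarrow> real mat" where
  "ridge_gram lam F = F\<^sup>T * F + lam \<cdot>\<^sub>m 1\<^sub>m (dim_col F)"

lemma ridge_gram_carrier: "F \<in> carrier_mat r d \<Longrightarrow> ridge_gram lam F \<in> carrier_mat d d"
  by (auto simp: ridge_gram_def)

lemma ridge_gram_mult_vec:
  assumes F: "F \<in> carrier_mat r d" and v: "v \<in> carrier_vec d"
  shows "ridge_gram lam F *\<^sub>v v = F\<^sup>T *\<^sub>v (F *\<^sub>v v) + lam \<cdot>\<^sub>v v"
proof -
  have "(lam \<cdot>\<^sub>m 1\<^sub>m d) *\<^sub>v v = lam \<cdot>\<^sub>v v"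
    using v by (intro eq_vecI) auto
  then show ?thesis
    using F v unfolding ridge_gram_def
    by (subst add_mult_distrib_mat_vec[of _ d d]) auto
qed

text \<open>Moving \<open>F\<^sup>T\<close> across the scalar product leaves a sum of squares;
  positivity and nonsingularity are both read off from it.\<close>

lemma ridge_gram_quadratic:
  assumes F: "F \<in> carrier_mat r d" and v: "v \<in> carrier_vec d"
  shows "(ridge_gram lam F *\<^sub>v v) \<bullet> v = (F *\<^sub>v v) \<bullet> (F *\<^sub>v v) + lam * (v \<bullet> v)"
  using F v
  by (simp add: ridge_gram_mult_vec[OF F v] add_scalar_prod_distrib[of _ d]
      transpose_vec_mult_scalar[OF F v])

lemma ridge_gram_nonneg:
  assumes "F \<in> carrier_mat r d" "v \<in> carrier_vec d" "lam > 0"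
  shows "0 \<le> (ridge_gram lam F *\<^sub>v v) \<bullet> v"
  using assms(3) scalar_prod_self_nonneg
  by (simp add: ridge_gram_quadratic[OF assms(1,2)])

text \<open>A kernel vector makes the quadratic form vanish, and its term weighted by
  \<open>lam > 0\<close> then forces the vector to be 0, whatever the rank of
  \<open>F\<close>.\<close>

lemma ridge_gram_mat_inv:
  assumes F: "F \<in> carrier_mat r d" and lam: "lam > 0"
  shows "mat_inv (ridge_gram lam F) \<in> carrier_mat d d"
    "ridge_gram lam F * mat_inv (ridge_gram lam F) = 1\<^sub>m d"
proof -
  have "v = 0\<^sub>v d" if v: "v \<in> carrier_vec d" and Av: "ridge_gram lam F *\<^sub>v v = 0\<^sub>v d" for v
  proof -
    have "(F *\<^sub>v v) \<bullet> (F *\<^sub>v v) + lam * (v \<bullet> v) = 0"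
      using ridge_gram_quadratic[OF F v, of lam] Av v by simp
    then have "lam * (v \<bullet> v) \<le> 0"
      using scalar_prod_self_nonneg[of "F *\<^sub>v v"] by linarith
    then show ?thesis
      using lam scalar_prod_self_eq_0[OF v] by (simp add: mult_le_0_iff)
  qed
  from nonsingular_mat_inv[OF ridge_gram_carrier[OF F] this]
  show "mat_inv (ridge_gram lam F) \<in> carrier_mat d d"
    "ridge_gram lam F * mat_inv (ridge_gram lam F) = 1\<^sub>m d"
    by blast+
qed

section \<open>The Woodbury update\<close>

text \<open>With \<open>P = F\<^sup>T\<close> and \<open>Q = mat_inv S * F * M\<close>, where
  \<open>S\<close> is the matrix inverted in \<open>M'\<close>, one finds
  \<open>A * M' = I - P * Q\<close> and \<open>F * M' = Q\<close>, so the two contributions add up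
  to \<open>I\<close>. The assumption \<open>nonneg\<close> serves to make \<open>S\<close>
  nonsingular.\<close>

lemma woodbury:
  fixes A M F :: "real mat"
  assumes A: "A \<in> carrier_mat d d" and M: "M \<in> carrier_mat d d" and F: "F \<in> carrier_mat s d"
    and AM: "A * M = 1\<^sub>m d"
    and nonneg: "\<And>v. v \<in> carrier_vec d \<Longrightarrow> 0 \<le> (A *\<^sub>v v) \<bullet> v"
  defines "M' \<equiv> M - M * F\<^sup>T * mat_inv (1\<^sub>m s + F * M * F\<^sup>T) * F * M"
  shows "M' \<in> carrier_mat d d" "(A + F\<^sup>T * F) * M' = 1\<^sub>m d"
proof -
  \<comment> \<open>\<open>S v = 0\<close> gives \<open>0 = v \<bullet> S v = v \<bullet> v + (A y) \<bullet> y\<close> with \<open>y = M F\<^sup>T v\<close>, so \<open>S\<close> is nonsingular.\<close>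
  define S where "S = 1\<^sub>m s + F * M * F\<^sup>T"
  define T where "T = mat_inv S"
  define P where "P = F\<^sup>T"
  define H where "H = F * M"
  define Q where "Q = T * H"
  have P: "P \<in> carrier_mat d s" and H: "H \<in> carrier_mat s d" and S: "S \<in> carrier_mat s s"
    using F M by (auto simp: P_def H_def S_def)
  have SHP: "S = 1\<^sub>m s + H * P"
    by (simp add: S_def H_def P_def)
  have HP: "H * P \<in> carrier_mat s s"
    using H P by simp
  have "v = 0\<^sub>v s" if v: "v \<in> carrier_vec s" and Sv: "S *\<^sub>v v = 0\<^sub>v s" for v
  proof -
    define z where "z = P *\<^sub>v v"
    have z: "z \<in> carrier_vec d" and Mz: "M *\<^sub>v z \<in> carrier_vec d"
      using P v M by (auto simp: z_def)
    have AMz: "A *\<^sub>v (M *\<^sub>v z) = z"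
      using assoc_mult_mat_vec[OF A M z] AM z by simp
    have Hz: "H *\<^sub>v z \<in> carrier_vec s"
      using H z by simp
    have "S *\<^sub>v v = v + H *\<^sub>v z"
      using add_mult_distrib_mat_vec[OF one_carrier_mat HP v] v
        assoc_mult_mat_vec[OF H P v] by (simp add: SHP z_def)
    then have "v + H *\<^sub>v z = 0\<^sub>v s"
      using Sv by simp
    then have "0 = v \<bullet> (v + H *\<^sub>v z)"
      unfolding \<open>v + H *\<^sub>v z = 0\<^sub>v s\<close> using v by simp
    also have "\<dots> = v \<bullet> v + v \<bullet> (F *\<^sub>v (M *\<^sub>v z))"
      using scalar_prod_add_distrib[OF v v Hz] assoc_mult_mat_vec[OF F M z]
      by (simp add: H_def)
    also have "v \<bullet> (F *\<^sub>v (M *\<^sub>v z)) = z \<bullet> (M *\<^sub>v z)"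
      using transpose_vec_mult_scalar[OF F Mz v] by (simp add: z_def P_def)
    finally have "v \<bullet> v \<le> 0"
      using nonneg[OF Mz] AMz by simp
    then show ?thesis
      by (rule scalar_prod_self_eq_0[OF v])
  qed
  from nonsingular_mat_inv[OF S this]
  have T: "T \<in> carrier_mat s s" and ST: "S * T = 1\<^sub>m s"
    by (auto simp: T_def)
  have Q: "Q \<in> carrier_mat s d" and PQ: "P * Q \<in> carrier_mat d d"
    using T H P by (auto simp: Q_def)
  \<comment> \<open>The only place where \<open>T\<close> is used as the inverse of
    \<open>S\<close>; below, \<open>S = I + H * P\<close> turns this into
    \<open>H = Q + H * P * Q\<close>.\<close>
  have SQ: "S * Q = H"
    using assoc_mult_mat[OF S T H] ST H by (simp add: Q_def)
  have "M * P * T * F * M = M * P * T * H"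
    using assoc_mult_mat[OF _ F M, of "M * P * T" d] M P T by (simp add: H_def)
  also have "\<dots> = M * P * Q"
    using assoc_mult_mat[OF _ T H, of "M * P" d] M P by (simp add: Q_def)
  also have "\<dots> = M * (P * Q)"
    by (rule assoc_mult_mat[OF M P Q])
  finally have M': "M' = M - M * (P * Q)"
    by (simp add: M'_def T_def S_def P_def)
  have MPQ: "M * (P * Q) \<in> carrier_mat d d"
    using M PQ by simp
  show M'c: "M' \<in> carrier_mat d d"
    unfolding M' by (rule minus_carrier_mat[OF MPQ])
  have "A * M' = 1\<^sub>m d - P * Q"
    using mult_minus_distrib_mat[OF A M MPQ] assoc_mult_mat[OF A M PQ] AM
      left_mult_one_mat[OF PQ]
    by (simp add: M')
  \<comment> \<open>\<open>F * M'\<close> equals \<open>H - H * P * Q\<close>, which is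
    \<open>S * Q - H * P * Q = Q\<close>.\<close>
  moreover have "P * F * M' = P * Q"
  proof -
    have "H = Q + H * P * Q"
      using add_mult_distrib_mat[OF one_carrier_mat HP Q] SQ Q by (simp add: SHP)
    then have "H - H * P * Q = Q"
      using Q H P by (intro eq_matI) (auto simp: mat_eq_iff)
    moreover have "F * M' = H - H * P * Q"
      using mult_minus_distrib_mat[OF F M MPQ] assoc_mult_mat[OF F M PQ]
        assoc_mult_mat[OF H P Q] by (simp add: M' H_def)
    ultimately show ?thesis
      using assoc_mult_mat[OF P F M'c] by simp
  qed
  ultimately have "(A + P * F) * M' = (1\<^sub>m d - P * Q) + P * Q"
    using add_mult_distrib_mat[OF A _ M'c, of "P * F"] P F by simp
  also have "\<dots> = 1\<^sub>m d"
    using PQ P Q by (intro eq_matI) auto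
  finally show "(A + F\<^sup>T * F) * M' = 1\<^sub>m d"
    by (simp add: P_def)
qed

section \<open>Block matrices: appending columns and stacking rows\<close>

lemma append_cols_carrier:
  assumes "A \<in> carrier_mat r a" "B \<in> carrier_mat r b"
  shows "append_cols A B \<in> carrier_mat r (a + b)"
  using assms by (auto simp: append_cols_def)

text \<open>Each column of a product depends on a single column of the right factor, so old and new
  classes can be treated separately.\<close>

lemma mult_append_cols:
  fixes A B C :: "'a :: semiring_0 mat"
  assumes C: "C \<in> carrier_mat q r" and A: "A \<in> carrier_mat r a" and B: "B \<in> carrier_mat r b"
  shows "C * append_cols A B = append_cols (C * A) (C * B)"
proof (rule eq_matI)
  fix i j
  assume "i < dim_row (append_cols (C * A) (C * B))" "j < dim_col (append_cols (C * A) (C * B))"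
  then have ij: "i < q" "j < a + b"
    using A B C by (auto simp: append_cols_def)
  have "col (append_cols A B) j = (if j < a then col A j else col B (j - a))"
    using ij A B by (intro eq_vecI) (auto simp: append_cols_def)
  then show "(C * append_cols A B) $$ (i, j) = append_cols (C * A) (C * B) $$ (i, j)"
    using ij A B C by (auto simp: append_cols_def)
qed (use A B C in \<open>auto simp: append_cols_def\<close>)

text \<open>A Gram matrix is a sum over rows, so stacking creates no cross terms, and the
  \<open>lam\<close> term is counted only once.\<close>

lemma ridge_gram_append_rows:
  assumes G: "G \<in> carrier_mat r d" and F: "F \<in> carrier_mat s d"
  shows "ridge_gram lam (G @\<^sub>r F) = ridge_gram lam G + F\<^sup>T * F"
proof -
  have "(G @\<^sub>r F)\<^sup>T * (G @\<^sub>r F) = G\<^sup>T * G + F\<^sup>T * F"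
    \<comment> \<open>\<open>append_rows\<close> is a \<open>four_block_mat\<close> whose right-hand
      blocks have no columns, hence the size arguments \<open>0\<close>; in the transpose the lower
      blocks have no rows.\<close>
    using G F unfolding append_rows_def
    by (subst transpose_four_block_mat[of _ r d _ 0 _ s], simp_all,
        subst mult_four_block_mat[of _ d r _ s _ 0 _ _ d _ 0], auto intro!: eq_matI)
  then show ?thesis
    using G F by (intro eq_matI) (auto simp: ridge_gram_def append_rows_def)
qed

text \<open>The zero off-diagonal blocks remove the cross terms between features of one domain and
  labels of another; this is where disjointness of the label sets enters.\<close>

lemma append_rows_transpose_mult_block_diag:
  fixes G F Y Z :: "'a :: semiring_0 mat"
  assumes G: "G \<in> carrier_mat r d" and F: "F \<in> carrier_mat s d"
    and Y: "Y \<in> carrier_mat r a" and Z: "Z \<in> carrier_mat s b"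
  shows "(G @\<^sub>r F)\<^sup>T * four_block_mat Y (0\<^sub>m r b) (0\<^sub>m s a) Z
    = append_cols (G\<^sup>T * Y) (F\<^sup>T * Z)"
  using assms unfolding append_rows_def append_cols_def
  by (subst transpose_four_block_mat[of _ r d _ 0 _ s], simp_all,
      subst mult_four_block_mat[of _ d r _ s _ 0 _ _ a _ b], auto intro!: cong_four_block_mat)

lemma mat_of_rows_append:
  assumes "set xs \<subseteq> carrier_vec d" "set ys \<subseteq> carrier_vec d"
  shows "mat_of_rows d (xs @ ys) = mat_of_rows d xs @\<^sub>r mat_of_rows d ys"
  by (intro eq_matI) (auto simp: append_rows_def mat_of_rows_def nth_append)

lemma stack_rows_snoc:
  assumes "\<And>A. A \<in> set As \<Longrightarrow> dim_col A = d" "B \<in> carrier_mat s d"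
  shows "stack_rows d (As @ [B]) = stack_rows d As @\<^sub>r B"
proof -
  have "set (rows A) \<subseteq> carrier_vec d" if "A \<in> set As" for A
    using rows_carrier[of A] assms(1)[OF that] by simp
  then have "set (concat (map rows As)) \<subseteq> carrier_vec d" "set (rows B) \<subseteq> carrier_vec d"
    using rows_carrier[of B] assms(2) by auto
  then show ?thesis
    using assms(2) mat_of_rows_append[of "concat (map rows As)" d "rows B"]
      mat_of_rows_rows[of B]
    by (simp add: stack_rows_def)
qed

section \<open>Normal equations imply optimality\<close>

text \<open>Splits the matrix objective into independent vector problems, one per class.\<close>

lemma frob_norm_square:
  assumes "A \<in> carrier_mat r c"
  shows "(frob_norm A)\<^sup>2 = (\<Sum>j<c. col A j \<bullet> col A j)"
proof -
  have "(frob_norm A)\<^sup>2 = (\<Sum>i<r. \<Sum>j<c. (A $$ (i, j))\<^sup>2)"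
    using assms by (simp add: frob_norm_def sum_nonneg)
  also have "\<dots> = (\<Sum>j<c. \<Sum>i<r. (A $$ (i, j))\<^sup>2)"
    by (rule sum.swap)
  also have "\<dots> = (\<Sum>j<c. col A j \<bullet> col A j)"
    using assms by (auto simp: scalar_prod_def power2_eq_square lessThan_atLeast0 intro!: sum.cong)
  finally show ?thesis .
qed

lemma normal_equation_minimizes_vec:
  assumes F: "F \<in> carrier_mat r d" and y: "y \<in> carrier_vec r"
    and u: "u \<in> carrier_vec d" and w: "w \<in> carrier_vec d" and lam: "lam > 0"
    and normal: "ridge_gram lam F *\<^sub>v u = F\<^sup>T *\<^sub>v y"
  shows "(y - F *\<^sub>v u) \<bullet> (y - F *\<^sub>v u) + lam * (u \<bullet> u)
    \<le> (y - F *\<^sub>v w) \<bullet> (y - F *\<^sub>v w) + lam * (w \<bullet> w)"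
proof -
  have Fu: "F *\<^sub>v u \<in> carrier_vec r" and Fw: "F *\<^sub>v w \<in> carrier_vec r"
    using F u w by auto
  \<comment> \<open>The normal equation tested against an arbitrary \<open>x\<close>. The instances
    \<open>x = u\<close> and \<open>x = w\<close> eliminate \<open>y\<close> from the cross terms of
    both objectives.\<close>
  have dot: "y \<bullet> (F *\<^sub>v x) = (F *\<^sub>v u) \<bullet> (F *\<^sub>v x) + lam * (u \<bullet> x)"
    if x: "x \<in> carrier_vec d" for x
  proof -
    have "y \<bullet> (F *\<^sub>v x) = (ridge_gram lam F *\<^sub>v u) \<bullet> x"
      using transpose_vec_mult_scalar[OF F x y] normal by simp
    also have "\<dots> = (F\<^sup>T *\<^sub>v (F *\<^sub>v u)) \<bullet> x + (lam \<cdot>\<^sub>v u) \<bullet> x"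
      using F u x by (simp add: ridge_gram_mult_vec[OF F u] add_scalar_prod_distrib[of _ d])
    finally show ?thesis
      using transpose_vec_mult_scalar[OF F x Fu] u x by simp
  qed
  have sq: "(a - b) \<bullet> (a - b) = a \<bullet> a - 2 * (a \<bullet> b) + b \<bullet> b"
    if "a \<in> carrier_vec n" "b \<in> carrier_vec n" for a b :: "real vec" and n
    using that by (simp add: minus_scalar_prod_distrib[of _ n] scalar_prod_minus_distrib[of _ n]
        comm_scalar_prod[of b n a])
  \<comment> \<open>These are the expanded squares of \<open>F u - F w\<close> and, weighted by
    \<open>lam\<close>, of \<open>u - w\<close>; their sum is exactly the gap between the two
    objectives.\<close>
  have "(F *\<^sub>v u) \<bullet> (F *\<^sub>v u) - 2 * ((F *\<^sub>v u) \<bullet> (F *\<^sub>v w)) + (F *\<^sub>v w) \<bullet> (F *\<^sub>v w) \<ge> 0"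
    using scalar_prod_self_nonneg[of "F *\<^sub>v u - F *\<^sub>v w"] sq[OF Fu Fw] by simp
  moreover have "lam * (u \<bullet> u - 2 * (u \<bullet> w) + w \<bullet> w) \<ge> 0"
    using scalar_prod_self_nonneg[of "u - w"] sq[OF u w] lam by simp
  ultimately show ?thesis
    unfolding sq[OF y Fu] sq[OF y Fw] dot[OF u] dot[OF w]
    by (simp add: algebra_simps)
qed

lemma normal_equation_minimizes:
  assumes F: "F \<in> carrier_mat r d" and Y: "Y \<in> carrier_mat r c"
    and U: "U \<in> carrier_mat d c" and W: "W \<in> carrier_mat d c" and lam: "lam > 0"
    and normal: "ridge_gram lam F * U = F\<^sup>T * Y"
  shows "(frob_norm (Y - F * U))\<^sup>2 + lam * (frob_norm U)\<^sup>2
    \<le> (frob_norm (Y - F * W))\<^sup>2 + lam * (frob_norm W)\<^sup>2"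
proof -
  have objective: "(frob_norm (Y - F * V))\<^sup>2 + lam * (frob_norm V)\<^sup>2 =
      (\<Sum>j<c. (col Y j - F *\<^sub>v col V j) \<bullet> (col Y j - F *\<^sub>v col V j) + lam * (col V j \<bullet> col V j))"
    if V: "V \<in> carrier_mat d c" for V
  proof -
    have "Y - F * V \<in> carrier_mat r c"
      using Y F V by (auto intro: minus_carrier_mat)
    moreover have "col (Y - F * V) j = col Y j - F *\<^sub>v col V j" if "j < c" for j
      using that Y F V by (intro eq_vecI) auto
    ultimately show ?thesis
      by (simp add: frob_norm_square[of _ r c] frob_norm_square[OF V]
          sum.distrib sum_distrib_left)
  qed
  have "ridge_gram lam F *\<^sub>v col U j = F\<^sup>T *\<^sub>v col Y j" if j: "j < c" for j
    using col_mult2[OF ridge_gram_carrier[OF F] U j, of lam] col_mult2[OF _ Y j, of "F\<^sup>T" d]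
      normal F by simp
  then show ?thesis
    unfolding objective[OF U] objective[OF W]
    using Y U W lam by (intro sum_mono normal_equation_minimizes_vec[OF F]) auto
qed

section \<open>The invariant of the recursion\<close>

text \<open>Shapes, inverse property and normal equation go through one induction: the update of
  \<open>Wt\<close> uses the new \<open>Mp\<close>, whose correctness rests on the previous one. The
  induction starts at 1 because both recursions are unspecified at 0.\<close>

lemma Wt_normal_equation:
  assumes lam: "lam > 0"
    and \<Phi>: "\<And>i. i \<in> {1..n} \<Longrightarrow> \<Phi> i \<in> carrier_mat (m i) d"
    and Y: "\<And>i. i \<in> {1..n} \<Longrightarrow> Y i \<in> carrier_mat (m i) (c i)"
    and n: "1 \<le> n"
  shows "joint_features d \<Phi> n \<in> carrier_mat (\<Sum>i=1..n. m i) d \<and>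
    joint_labels Y n \<in> carrier_mat (\<Sum>i=1..n. m i) (\<Sum>i=1..n. c i) \<and>
    Mp lam d \<Phi> n \<in> carrier_mat d d \<and>
    ridge_gram lam (joint_features d \<Phi> n) * Mp lam d \<Phi> n = 1\<^sub>m d \<and>
    Wt lam d \<Phi> Y n \<in> carrier_mat d (\<Sum>i=1..n. c i) \<and>
    ridge_gram lam (joint_features d \<Phi> n) * Wt lam d \<Phi> Y n
      = (joint_features d \<Phi> n)\<^sup>T * joint_labels Y n"
  using n \<Phi> Y
proof (induction n rule: nat_induct_at_least)
  case base
  have F: "\<Phi> 1 \<in> carrier_mat (m 1) d" and Z: "Y 1 \<in> carrier_mat (m 1) (c 1)"
    using base(1)[of 1] base(2)[of 1] by simp_all
  have M: "Mp lam d \<Phi> 1 = mat_inv (ridge_gram lam (\<Phi> 1))"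
    using F by (simp add: ridge_gram_def)
  have FZ: "(\<Phi> 1)\<^sup>T * Y 1 \<in> carrier_mat d (c 1)"
    using F Z by simp
  note inv = ridge_gram_mat_inv[OF F lam, folded M]
  have W: "Wt lam d \<Phi> Y 1 = Mp lam d \<Phi> 1 * ((\<Phi> 1)\<^sup>T * Y 1)"
    using assoc_mult_mat[OF inv(1) _ Z, of "(\<Phi> 1)\<^sup>T"] F by simp
  have jf: "joint_features d \<Phi> 1 = \<Phi> 1"
    using F mat_of_rows_rows[of "\<Phi> 1"] by (simp add: joint_features_def stack_rows_def)
  have jl: "joint_labels Y 1 = Y 1"
    by (simp add: joint_labels_def del: diag_block_mat.simps)
  have "joint_features d \<Phi> 1 \<in> carrier_mat (\<Sum>i=1..1. m i) d"
    "joint_labels Y 1 \<in> carrier_mat (\<Sum>i=1..1. m i) (\<Sum>i=1..1. c i)"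
    "Mp lam d \<Phi> 1 \<in> carrier_mat d d"
    "ridge_gram lam (joint_features d \<Phi> 1) * Mp lam d \<Phi> 1 = 1\<^sub>m d"
    using F Z inv unfolding jf jl by auto
  moreover
  have "Wt lam d \<Phi> Y 1 \<in> carrier_mat d (\<Sum>i=1..1. c i)"
    unfolding W using mult_carrier_mat[OF inv(1) FZ] by simp
  moreover
  have "ridge_gram lam (joint_features d \<Phi> 1) * Wt lam d \<Phi> Y 1
      = (joint_features d \<Phi> 1)\<^sup>T * joint_labels Y 1"
    unfolding jf jl W
    using assoc_mult_mat[OF ridge_gram_carrier[OF F] inv(1) FZ, of lam] inv(2)
      left_mult_one_mat[OF FZ] by (simp only:)
  ultimately show ?case
    by blast
next
  case (Suc n)
  define G where "G = joint_features d \<Phi> n"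
  define L where "L = joint_labels Y n"
  define M where "M = Mp lam d \<Phi> n"
  define V where "V = Wt lam d \<Phi> Y n"
  define F where "F = \<Phi> (Suc n)"
  define Z where "Z = Y (Suc n)"
  define A where "A = ridge_gram lam G"
  define M' where "M' = Mp lam d \<Phi> (Suc n)"
  define A' where "A' = A + F\<^sup>T * F"
  let ?r = "\<Sum>i=1..n. m i" and ?s = "m (Suc n)" and ?a = "\<Sum>i=1..n. c i" and ?b = "c (Suc n)"
  \<comment> \<open>Exposes the pattern \<open>Suc (Suc k)\<close> on which the update clauses of
    \<open>Mp\<close> and \<open>Wt\<close> are defined.\<close>
  obtain k where k: "n = Suc k"
    using Suc.hyps by (cases n) auto
  have IH: "G \<in> carrier_mat ?r d" "L \<in> carrier_mat ?r ?a" "M \<in> carrier_mat d d"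
    "A * M = 1\<^sub>m d" "V \<in> carrier_mat d ?a" "A * V = G\<^sup>T * L"
    using Suc.IH Suc.prems by (auto simp: G_def L_def M_def V_def A_def)
  note G = IH(1) and L = IH(2) and M = IH(3) and AM = IH(4) and V = IH(5) and AV = IH(6)
  have F: "F \<in> carrier_mat ?s d" and Z: "Z \<in> carrier_mat ?s ?b"
    using Suc.prems by (auto simp: F_def Z_def)
  have A: "A \<in> carrier_mat d d"
    unfolding A_def by (rule ridge_gram_carrier[OF G])
  have nonneg: "0 \<le> (A *\<^sub>v v) \<bullet> v" if "v \<in> carrier_vec d" for v
    unfolding A_def using ridge_gram_nonneg[OF G that lam] .
  have "M' = M - M * F\<^sup>T * mat_inv (1\<^sub>m ?s + F * M * F\<^sup>T) * F * M"
    using F by (simp add: M'_def M_def F_def k Let_def)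
  with woodbury[OF A M F AM nonneg]
  have M': "M' \<in> carrier_mat d d" and A'M': "A' * M' = 1\<^sub>m d"
    by (simp_all add: A'_def)
  have Ft: "F\<^sup>T \<in> carrier_mat d ?s" and FtF: "F\<^sup>T * F \<in> carrier_mat d d"
    and A': "A' \<in> carrier_mat d d"
    using F A by (auto simp: A'_def)
  \<comment> \<open>Applied below with \<open>B\<close> equal to \<open>F\<^sup>T * F * V\<close>
    and to \<open>F\<^sup>T * Z\<close>, the two matrices that \<open>M'\<close> multiplies in the
    update.\<close>
  have A'M'_cancel: "A' * (M' * B) = B" if "B \<in> carrier_mat d q" for B q
    using assoc_mult_mat[OF A' M' that] A'M' left_mult_one_mat[OF that] by simp
  have FFV: "F\<^sup>T * F * V \<in> carrier_mat d ?a" and FZ: "F\<^sup>T * Z \<in> carrier_mat d ?b"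
    and MFFV: "M' * (F\<^sup>T * F * V) \<in> carrier_mat d ?a"
    and MFZ: "M' * (F\<^sup>T * Z) \<in> carrier_mat d ?b"
    using Ft FtF V Z M' by auto
  have W: "Wt lam d \<Phi> Y (Suc n) = append_cols (V - M' * (F\<^sup>T * F * V)) (M' * (F\<^sup>T * Z))"
  proof -
    have "Wt lam d \<Phi> Y (Suc n) = append_cols (V - M' * F\<^sup>T * F * V) (M' * F\<^sup>T * Z)"
      by (simp add: M'_def V_def F_def Z_def k Let_def)
    moreover have "M' * F\<^sup>T * F * V = M' * (F\<^sup>T * F * V)"
      using assoc_mult_mat[OF M' Ft F] assoc_mult_mat[OF M' FtF V] by simp
    moreover have "M' * F\<^sup>T * Z = M' * (F\<^sup>T * Z)"
      by (rule assoc_mult_mat[OF M' Ft Z])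
    ultimately show ?thesis by simp
  qed
  have left: "V - M' * (F\<^sup>T * F * V) \<in> carrier_mat d ?a"
    using MFFV by (rule minus_carrier_mat)
  \<comment> \<open>The correction offsets exactly the increment
    \<open>A' - A = F\<^sup>T * F\<close> acting on \<open>V\<close>, so the old columns keep their
    old right-hand side.\<close>
  have "A' * (V - M' * (F\<^sup>T * F * V)) = A' * V - F\<^sup>T * F * V"
    using mult_minus_distrib_mat[OF A' V MFFV] A'M'_cancel[OF FFV] by simp
  also have "A' * V = A * V + F\<^sup>T * F * V"
    unfolding A'_def by (rule add_mult_distrib_mat[OF A FtF V])
  also have "A * V + F\<^sup>T * F * V - F\<^sup>T * F * V = G\<^sup>T * L"
    unfolding AV using F V G L by (intro eq_matI) auto
  finally have A'W: "A' * Wt lam d \<Phi> Y (Suc n) = append_cols (G\<^sup>T * L) (F\<^sup>T * Z)"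
    using mult_append_cols[OF A' left MFZ] A'M'_cancel[OF FZ] by (simp add: W)
  have jf: "joint_features d \<Phi> (Suc n) = G @\<^sub>r F"
    unfolding joint_features_def G_def F_def
    using stack_rows_snoc[of "map \<Phi> [1..<Suc n]" d "\<Phi> (Suc n)" ?s] Suc.prems(1) by force
  \<comment> \<open>\<open>diag_block_mat\<close> recurses from the front of the list, whereas a new
    domain arrives at its end; \<open>diag_block_mat_last\<close> bridges the two.\<close>
  have jl: "joint_labels Y (Suc n) = four_block_mat L (0\<^sub>m ?r ?b) (0\<^sub>m ?s ?a) Z"
    using diag_block_mat_last[of "map Y [1..<Suc n]" "Y (Suc n)"] L Z
    by (simp add: joint_labels_def L_def Z_def Let_def)
  have A'_joint: "ridge_gram lam (joint_features d \<Phi> (Suc n)) = A'"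
    unfolding jf A'_def A_def by (rule ridge_gram_append_rows[OF G F])
  have "joint_features d \<Phi> (Suc n) \<in> carrier_mat (\<Sum>i=1..Suc n. m i) d"
    unfolding jf using carrier_append_rows[OF G F] by simp
  moreover have "joint_labels Y (Suc n) \<in> carrier_mat (\<Sum>i=1..Suc n. m i) (\<Sum>i=1..Suc n. c i)"
    unfolding jl using four_block_carrier_mat[OF L Z] by simp
  moreover have "Mp lam d \<Phi> (Suc n) \<in> carrier_mat d d"
    using M' by (simp add: M'_def)
  moreover have "ridge_gram lam (joint_features d \<Phi> (Suc n)) * Mp lam d \<Phi> (Suc n) = 1\<^sub>m d"
    using A'M' by (simp add: M'_def A'_joint)
  moreover have "Wt lam d \<Phi> Y (Suc n) \<in> carrier_mat d (\<Sum>i=1..Suc n. c i)"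
    unfolding W using append_cols_carrier[OF left MFZ] by simp
  moreover have "ridge_gram lam (joint_features d \<Phi> (Suc n)) * Wt lam d \<Phi> Y (Suc n)
      = (joint_features d \<Phi> (Suc n))\<^sup>T * joint_labels Y (Suc n)"
    unfolding A'_joint A'W unfolding jf jl
    by (rule append_rows_transpose_mult_block_diag[OF G F L Z, symmetric])
  ultimately show ?case
    by blast
qed

section \<open>Optimality of the recursive weights\<close>

theorem theorem1:
  fixes lam :: real and N p d :: nat
    and m c :: "nat \<Rightarrow> nat"
    and \<phi> :: "real vec \<Rightarrow> real vec"
    and X \<Phi> Y :: "nat \<Rightarrow> real mat"
  assumes "lam > 0" and "N \<ge> 2"
    and "\<And>x. x \<in> carrier_vec p \<Longrightarrow> \<phi> x \<in> carrier_vec d"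
    and "\<And>i. i \<in> {1..N} \<Longrightarrow> X i \<in> carrier_mat (m i) p"
    and "\<And>i. i \<in> {1..N} \<Longrightarrow> \<Phi> i = feature_mat d \<phi> (X i)"
    and "\<And>i. i \<in> {1..N} \<Longrightarrow> Y i \<in> carrier_mat (m i) (c i)"
    and "\<And>i. i \<in> {1..N} \<Longrightarrow> one_hot_rows (Y i)"
  shows "\<forall>n\<in>{2..N}.
    Wt lam d \<Phi> Y n \<in> carrier_mat d (\<Sum>i=1..n. c i) \<and>
    (\<forall>W \<in> carrier_mat d (\<Sum>i=1..n. c i).
       joint_objective lam d \<Phi> Y n (Wt lam d \<Phi> Y n) \<le> joint_objective lam d \<Phi> Y n W)"
proof
  fix n
  assume n: "n \<in> {2..N}"
  have \<Phi>: "\<Phi> i \<in> carrier_mat (m i) d" if "i \<in> {1..n}" for i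
    using that n assms(4)[of i] assms(5)[of i] by (auto simp: feature_mat_def)
  have Y: "Y i \<in> carrier_mat (m i) (c i)" if "i \<in> {1..n}" for i
    using that n assms(6)[of i] by simp
  have "1 \<le> n"
    using n by simp
  note joint = Wt_normal_equation[of lam n \<Phi> m d Y c, OF assms(1) \<Phi> Y this]
  show "Wt lam d \<Phi> Y n \<in> carrier_mat d (\<Sum>i=1..n. c i) \<and>
    (\<forall>W \<in> carrier_mat d (\<Sum>i=1..n. c i).
       joint_objective lam d \<Phi> Y n (Wt lam d \<Phi> Y n) \<le> joint_objective lam d \<Phi> Y n W)"
    unfolding joint_objective_def
    using joint normal_equation_minimizes[OF _ _ _ _ assms(1), of "joint_features d \<Phi> n"] by blast
qed

end
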